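(* Let $n\ge 1$ and $f:\mathbb{R}^n\to\mathbb{R}\cup\{+\infty\}$, with $X=\{x\in\mathbb{R}^n: f(x)\ne+\infty\}$, satisfy: (a) $f$ is bounded below and all its sublevel sets are bounded; (b) the restriction $f_{|X}:X\to\mathbb{R}$ is lower semicontinuous; (c) there are $N\in\mathbb{N}^*\cup\{+\infty\}$ and a partition $X=\bigsqcup_{i=1}^N X_i$ such that, for every $i$, $X_i$ is ample and $f_{|X_i}:X_i\to\mathbb{R}$ is continuous. Consider any run of the covering direct search method (cDSM, defined in the context) on $f$ with covering radius $r>0$, generating $(x^k,\delta^k,\mathcal{H}^k)_{k\in\mathbb{N}}$. Then the run generates at least one refining subsequence. Moreover, if the dense covering property $$\mathcal{B}_r(x^* )\subseteq \mathrm{cl}(\mathcal{H})\quad\text{for every refined point } x^*\in\mathcal{R}$$ holds, then for every $K^*\subseteq\mathbb{N}$ indexing a refining subsequence, with refined point $x^*$, $$\lim_{k\in K^*} f(x^k)=\begin{cases}\min f(\mathcal{B}_r(x^* ))=f(x^* ) & \text{if } x^*\in X,\\ \inf f(\mathcal{B}_r(x^* )) & \text{if } x^*\notin X.\end{cases}$$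
   Context: Notation: $\mathcal{B}_r(x)$ is the open ball of radius $r$ centered at $x$ (for a fixed norm $\|\cdot\|$ on $\mathbb{R}^n$), $\mathcal{B}_r=\mathcal{B}_r(0)$, $\mathrm{cl}$ and $\mathrm{int}$ are closure and interior, $f(S)=\{f(s):s\in S\}$, $\{x\}+S=\{x+s:s\in S\}$, and "$t\in\operatorname{argmin} f(S)$" means that $t$ minimizes $f$ over $S$. A set $S\subseteq\mathbb{R}^n$ is ample if $S\subseteq\mathrm{cl}(\mathrm{int}(S))$. A positive basis of $\mathbb{R}^n$ is a minimal set whose nonnegative linear combinations give all of $\mathbb{R}^n$. The cDSM. Initialization: choose a covering radius $r>0$; $\mathcal{H}^0=\emptyset$; $x^0\in X$, $\delta^0>0$, $\underline{\delta}^0=\delta^0$; $\tau\in{]0,1[}\cap\mathbb{Q}$; and choose $\mathcal{M}:\mathbb{R}_+\to 2^{\mathbb{R}^n}$ and $\rho:\mathbb{R}_+\to\mathbb{R}_+$ according to one of the two options: (mesh-based) $\mathcal{M}(\nu)=\min\{\nu,\nu^2/\delta^0\}\,\mathbb{Z}^n$ and $\rho(\nu)=0$ for all $\nu$; (sufficient decrease-based) $\mathcal{M}(\nu)=\mathbb{R}^n$ and $\rho(\nu)=\min\{\nu,\nu^2/\delta^0\}$ for all $\nu$. For each $k=0,1,2,\dots$: - Covering step: choose $\mathcal{D}_C^k\subseteq\mathcal{M}(\underline{\delta}^k)\cap\mathrm{cl}(\mathcal{B}_r)$ nonempty and finite; $\mathcal{T}_C^k=\{x^k\}+\mathcal{D}_C^k$;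 choose $t_C^k\in\operatorname{argmin} f(\mathcal{T}_C^k)$. If $f(t_C^k)<f(x^k)-\rho(\underline{\delta}^k)$, set $t^k=t_C^k$, $\mathcal{T}_S^k=\mathcal{T}_P^k=\emptyset$, and go to the update step. - Search step: choose $\mathcal{D}_S^k\subseteq\mathcal{M}(\underline{\delta}^k)$ empty or finite; $\mathcal{T}_S^k=\{x^k\}+\mathcal{D}_S^k$. If $\mathcal{T}_S^k\neq\emptyset$, choose $t_S^k\in\operatorname{argmin} f(\mathcal{T}_S^k)$; if also $f(t_S^k)<f(x^k)-\rho(\underline{\delta}^k)$, set $t^k=t_S^k$, $\mathcal{T}_P^k=\emptyset$, and go to the update step. - Poll step: choose $\mathcal{D}_P^k\subseteq\mathcal{M}(\underline{\delta}^k)\cap\mathrm{cl}(\mathcal{B}_{\delta^k})$ a positive basis of $\mathbb{R}^n$; $\mathcal{T}_P^k=\{x^k\}+\mathcal{D}_P^k$; choose $t_P^k\in\operatorname{argmin} f(\mathcal{T}_P^k)$. If $f(t_P^k)<f(x^k)-\rho(\underline{\delta}^k)$ set $t^k=t_P^k$, otherwise set $t^k=x^k$. - Update step: $\mathcal{T}^k=\mathcal{T}_C^k\cup\mathcal{T}_S^k\cup\mathcal{T}_P^k$; $\mathcal{H}^{k+1}=\mathcal{H}^k\cup\mathcal{T}^k$; $x^{k+1}=t^k$; $\delta^{k+1}=\delta^k/\tau$ if $t^k\ne x^k$ and $\delta^{k+1}=\tau\delta^k$ otherwise; $\underline{\delta}^{k+1}=\min\{\underline{\delta}^k,\delta^{k+1}\}$.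 An infinite set $K^*\subseteq\mathbb{N}$ indexes a refining subsequence $(x^k,\delta^k)_{k\in K^*}$ if $x^{k+1}=x^k$ for all $k\in K^*$ (iteration $k$ fails), $(\delta^k)_{k\in K^*}$ converges to $0$, and $(x^k)_{k\in K^*}$ converges to a point $x^*$, called the refined point. $\mathcal{R}$ is the set of all refined points over all refining subsequences of the run, and $\mathcal{H}=\bigcup_{k\in\mathbb{N}}\mathcal{H}^k$. *)

theory Defs
  imports "HOL-Analysis.Analysis"
begin

(* The norm defining the balls is an arbitrary norm on R^n, not necessarily the Euclidean one.
   Closures, interiors, limits and boundedness do not depend on this choice, so the library
   notions are used for them. *)

definition is_norm :: "('a::real_vector \<Rightarrow> real) \<Rightarrow> bool" where
  "is_norm N \<longleftrightarrow>
     (\<forall>v. 0 \<le> N v) \<and> (\<forall>v. N v = 0 \<longleftrightarrow> v = 0) \<and>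
     (\<forall>a v. N (a *\<^sub>R v) = \<bar>a\<bar> * N v) \<and> (\<forall>v w. N (v + w) \<le> N v + N w)"

definition norm_ball :: "('a::real_vector \<Rightarrow> real) \<Rightarrow> real \<Rightarrow> 'a \<Rightarrow> 'a set" where
  "norm_ball N s x = {y. N (y - x) < s}"

definition edom :: "('a \<Rightarrow> ereal) \<Rightarrow> 'a set" where
  "edom f = {x. f x \<noteq> \<infinity>}"

definition ample :: "'a::topological_space set \<Rightarrow> bool" where
  "ample S \<longleftrightarrow> S \<subseteq> closure (interior S)"

definition lsc_on :: "'a::topological_space set \<Rightarrow> ('a \<Rightarrow> real) \<Rightarrow> bool" where
  "lsc_on S g \<longleftrightarrow> (\<forall>x\<in>S. \<forall>c<g x. \<forall>\<^sub>F y in at x within S. c < g y)"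

definition nonneg_combinations :: "'a::real_vector set \<Rightarrow> 'a set" where
  "nonneg_combinations S =
     {\<Sum>v\<in>F. c v *\<^sub>R v | F c. finite F \<and> F \<subseteq> S \<and> (\<forall>v\<in>F. 0 \<le> c v)}"

definition positive_basis :: "'a::real_vector set \<Rightarrow> bool" where
  "positive_basis D \<longleftrightarrow>
     nonneg_combinations D = UNIV \<and> (\<forall>D'. D' \<subset> D \<longrightarrow> nonneg_combinations D' \<noteq> UNIV)"

definition argmin_on :: "('a \<Rightarrow> ereal) \<Rightarrow> 'a set \<Rightarrow> 'a \<Rightarrow> bool" where
  "argmin_on f S t \<longleftrightarrow> is_arg_min f (\<lambda>s. s \<in> S) t"

definition mesh_based :: "real \<Rightarrow> (real \<Rightarrow> (real ^ 'n) set) \<Rightarrow> (real \<Rightarrow> real) \<Rightarrow> bool" where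
  "mesh_based \<delta>0 M \<rho> \<longleftrightarrow>
     (\<forall>\<nu>\<ge>0. M \<nu> = (\<lambda>z. min \<nu> (\<nu>\<^sup>2 / \<delta>0) *\<^sub>R z) ` {z. \<forall>i. z $ i \<in> \<int>} \<and> \<rho> \<nu> = 0)"

definition sufficient_decrease_based ::
    "real \<Rightarrow> (real \<Rightarrow> (real ^ 'n) set) \<Rightarrow> (real \<Rightarrow> real) \<Rightarrow> bool" where
  "sufficient_decrease_based \<delta>0 M \<rho> \<longleftrightarrow>
     (\<forall>\<nu>\<ge>0. M \<nu> = UNIV \<and> \<rho> \<nu> = min \<nu> (\<nu>\<^sup>2 / \<delta>0))"

(* cdsm_iteration N f r M \<rho> x \<delta> \<nu> t T: from the incumbent x, with poll radius \<delta> and smallest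
   radius so far \<nu>, one pass of the covering, search and poll steps can return the point t after
   evaluating f on the trial set T. *)

definition cdsm_iteration ::
    "(real ^ 'n \<Rightarrow> real) \<Rightarrow> (real ^ 'n \<Rightarrow> ereal) \<Rightarrow> real \<Rightarrow>
     (real \<Rightarrow> (real ^ 'n) set) \<Rightarrow> (real \<Rightarrow> real) \<Rightarrow>
     real ^ 'n \<Rightarrow> real \<Rightarrow> real \<Rightarrow> real ^ 'n \<Rightarrow> (real ^ 'n) set \<Rightarrow> bool" where
  "cdsm_iteration N f r M \<rho> x \<delta> \<nu> t T \<longleftrightarrow>
     (\<exists>D\<^sub>C T\<^sub>C t\<^sub>C T\<^sub>S T\<^sub>P.
        T = T\<^sub>C \<union> T\<^sub>S \<union> T\<^sub>P \<and>
        D\<^sub>C \<subseteq> M \<nu> \<inter> closure (norm_ball N r 0) \<and> D\<^sub>C \<noteq> {} \<and> finite D\<^sub>C \<and>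
        T\<^sub>C = (\<lambda>d. x + d) ` D\<^sub>C \<and> argmin_on f T\<^sub>C t\<^sub>C \<and>
        (if f t\<^sub>C < f x - ereal (\<rho> \<nu>) then t = t\<^sub>C \<and> T\<^sub>S = {} \<and> T\<^sub>P = {}
         else (\<exists>D\<^sub>S t\<^sub>S.
           D\<^sub>S \<subseteq> M \<nu> \<and> finite D\<^sub>S \<and> T\<^sub>S = (\<lambda>d. x + d) ` D\<^sub>S \<and>
           (T\<^sub>S \<noteq> {} \<longrightarrow> argmin_on f T\<^sub>S t\<^sub>S) \<and>
           (if T\<^sub>S \<noteq> {} \<and> f t\<^sub>S < f x - ereal (\<rho> \<nu>) then t = t\<^sub>S \<and> T\<^sub>P = {}
            else (\<exists>D\<^sub>P t\<^sub>P.
              D\<^sub>P \<subseteq> M \<nu> \<inter> closure (norm_ball N \<delta> 0) \<and> positive_basis D\<^sub>P \<and>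
              T\<^sub>P = (\<lambda>d. x + d) ` D\<^sub>P \<and> argmin_on f T\<^sub>P t\<^sub>P \<and>
              t = (if f t\<^sub>P < f x - ereal (\<rho> \<nu>) then t\<^sub>P else x))))))"

(* \<nu> k is the smallest of \<delta> 0, ..., \<delta> k. *)

definition cdsm_run ::
    "(real ^ 'n \<Rightarrow> real) \<Rightarrow> (real ^ 'n \<Rightarrow> ereal) \<Rightarrow> real \<Rightarrow> real \<Rightarrow>
     (real \<Rightarrow> (real ^ 'n) set) \<Rightarrow> (real \<Rightarrow> real) \<Rightarrow>
     (nat \<Rightarrow> real ^ 'n) \<Rightarrow> (nat \<Rightarrow> real) \<Rightarrow> (nat \<Rightarrow> real) \<Rightarrow> (nat \<Rightarrow> (real ^ 'n) set) \<Rightarrow> bool" where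
  "cdsm_run N f r \<tau> M \<rho> x \<delta> \<nu> H \<longleftrightarrow>
     0 < r \<and> H 0 = {} \<and> x 0 \<in> edom f \<and> 0 < \<delta> 0 \<and> \<nu> 0 = \<delta> 0 \<and>
     0 < \<tau> \<and> \<tau> < 1 \<and> \<tau> \<in> \<rat> \<and>
     (mesh_based (\<delta> 0) M \<rho> \<or> sufficient_decrease_based (\<delta> 0) M \<rho>) \<and>
     (\<forall>k. \<exists>t T.
        cdsm_iteration N f r M \<rho> (x k) (\<delta> k) (\<nu> k) t T \<and>
        H (Suc k) = H k \<union> T \<and>
        x (Suc k) = t \<and>
        \<delta> (Suc k) = (if t \<noteq> x k then \<delta> k / \<tau> else \<tau> * \<delta> k) \<and>
        \<nu> (Suc k) = min (\<nu> k) (\<delta> (Suc k)))"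

(* For infinite K, enumerate K lists K increasingly, so that x \<circ> enumerate K is the subsequence
   of x indexed by K. *)

definition indexes_refining ::
    "(nat \<Rightarrow> 'a::topological_space) \<Rightarrow> (nat \<Rightarrow> real) \<Rightarrow> nat set \<Rightarrow> 'a \<Rightarrow> bool" where
  "indexes_refining x \<delta> K xs \<longleftrightarrow>
     infinite K \<and> (\<forall>k\<in>K. x (Suc k) = x k) \<and>
     (\<delta> \<circ> enumerate K) \<longlonglongrightarrow> 0 \<and> (x \<circ> enumerate K) \<longlonglongrightarrow> xs"

definition refined_points :: "(nat \<Rightarrow> 'a::topological_space) \<Rightarrow> (nat \<Rightarrow> real) \<Rightarrow> 'a set" where
  "refined_points x \<delta> = {xs. \<exists>K. indexes_refining x \<delta> K xs}"

end

theory Submission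
  imports Defs
begin

text \<open>
  Why the theorem holds. Every accepted move lowers \<open>f\<close>, so the incumbents stay in one bounded
  sublevel set and the values \<open>f (x k)\<close> decrease to a real limit \<open>L\<close>.

  The poll radii always have the form \<open>\<delta> k = \<nu> k / \<tau> ^ i\<close>, so \<open>\<nu>\<close> only changes
  by a factor \<open>\<tau>\<close>, at an unsuccessful iteration with \<open>\<delta> k = \<nu> k\<close>. If this happened
  finitely often, \<open>\<nu>\<close> would end up constant and positive. The successes would then be finite in
  number: on a mesh, because the incumbents would be confined to the finitely many points of one
  lattice in a bounded set; with sufficient decrease, because each success would lower \<open>f\<close> by a
  fixed amount. But then \<open>\<delta>\<close> would shrink to \<open>0\<close>, below \<open>\<nu>\<close>. Hence \<open>\<nu>\<close> drops
  infinitely often and tends to \<open>0\<close> (\<open>infinitely_many_drops\<close>, \<open>min_radius_tendsto_zero\<close>), and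
  by compactness a subsequence of the drops is refining (\<open>refining_subsequence_exists\<close>).

  For the limit, the key is that a point evaluated at iteration \<open>k\<close> has a value at least
  \<open>L - \<rho> (\<nu> k)\<close>, whether the iteration succeeded or not. Only finitely many points are
  evaluated in each iteration, positive bases being finite; so an open set in which the evaluated
  points are dense contains points evaluated arbitrarily late, with values at least
  \<open>L - \<epsilon>\<close> (\<open>late_trial_point\<close>). On the other hand, if \<open>f y < L\<close> at some \<open>y\<close> in
  the ball, ampleness of the part containing \<open>y\<close> and continuity on that part give a whole open
  subset of the ball on which \<open>f\<close> stays below some \<open>c < L\<close>
  (\<open>open_set_below_on_ample\<close>). These facts conflict, so \<open>L\<close> is a lower bound of \<open>f\<close>
  on the ball. It is the infimum since the incumbents enter the ball, and lower
  semicontinuity gives \<open>f xs \<le> L\<close> when the refined point \<open>xs\<close> lies in the domain.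
\<close>

section \<open>Norm balls and positive bases\<close>

lemma open_norm_ball:
  fixes N :: "'a::euclidean_space \<Rightarrow> real"
  assumes "is_norm N"
  shows "open (norm_ball N s x)"
proof -
  have N: "N (a *\<^sub>R v) = \<bar>a\<bar> * N v" "N (v + w) \<le> N v + N w" for a v w
    using assms unfolding is_norm_def by auto
  have "convex_on UNIV N"
  proof (rule convex_onI)
    fix t :: real and v w :: 'a
    assume "0 < t" "t < 1"
    then show "N ((1 - t) *\<^sub>R v + t *\<^sub>R w) \<le> (1 - t) * N v + t * N w"
      using N(2)[of "(1 - t) *\<^sub>R v" "t *\<^sub>R w"] by (simp add: N(1))
  qed simp
  then have cont: "continuous_on UNIV N"
    by (simp add: convex_on_continuous)
  have "continuous_on UNIV (\<lambda>y. N (y - x))"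
    by (rule continuous_on_compose2[OF cont]) (auto intro: continuous_intros)
  then show ?thesis
    unfolding norm_ball_def by (intro open_Collect_less continuous_intros)
qed

lemma center_in_norm_ball:
  assumes "is_norm N" "0 < s"
  shows "x \<in> norm_ball N s x"
proof -
  have "N 0 = 0"
    using assms(1) unfolding is_norm_def by blast
  then show ?thesis
    using assms(2) by (simp add: norm_ball_def)
qed

lemma zero_in_nonneg_combinations: "0 \<in> nonneg_combinations S"
  unfolding nonneg_combinations_def by (auto intro!: exI[of _ "{}"])

lemma add_in_nonneg_combinations:
  assumes "v \<in> nonneg_combinations S" "w \<in> nonneg_combinations S"
  shows "v + w \<in> nonneg_combinations S"
proof -
  obtain F c where F: "finite F" "F \<subseteq> S" "\<forall>u\<in>F. 0 \<le> c u" "v = (\<Sum>u\<in>F. c u *\<^sub>R u)"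
    using assms(1) unfolding nonneg_combinations_def by auto
  obtain G d where G: "finite G" "G \<subseteq> S" "\<forall>u\<in>G. 0 \<le> d u" "w = (\<Sum>u\<in>G. d u *\<^sub>R u)"
    using assms(2) unfolding nonneg_combinations_def by auto
  define e where "e u = (if u \<in> F then c u else 0) + (if u \<in> G then d u else 0)" for u
  have "(\<Sum>u\<in>F. c u *\<^sub>R u) = (\<Sum>u\<in>F \<union> G. (if u \<in> F then c u else 0) *\<^sub>R u)"
    using F(1) G(1) by (intro sum.mono_neutral_cong_left) auto
  moreover have "(\<Sum>u\<in>G. d u *\<^sub>R u) = (\<Sum>u\<in>F \<union> G. (if u \<in> G then d u else 0) *\<^sub>R u)"
    using F(1) G(1) by (intro sum.mono_neutral_cong_left) auto
  ultimately have "v + w = (\<Sum>u\<in>F \<union> G. e u *\<^sub>R u)"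
    by (simp add: F(4) G(4) e_def scaleR_add_left sum.distrib)
  moreover have "\<forall>u\<in>F \<union> G. 0 \<le> e u"
    using F(3) G(3) by (auto simp: e_def)
  ultimately show ?thesis
    unfolding nonneg_combinations_def using F(1,2) G(1,2)
    by (intro CollectI exI[of _ "F \<union> G"] exI[of _ e]) simp
qed

lemma scale_in_nonneg_combinations:
  assumes "v \<in> nonneg_combinations S" "0 \<le> a"
  shows "a *\<^sub>R v \<in> nonneg_combinations S"
proof -
  obtain F c where F: "finite F" "F \<subseteq> S" "\<forall>u\<in>F. 0 \<le> c u" "v = (\<Sum>u\<in>F. c u *\<^sub>R u)"
    using assms(1) unfolding nonneg_combinations_def by auto
  have "a *\<^sub>R v = (\<Sum>u\<in>F. (a * c u) *\<^sub>R u)"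
    by (simp add: F(4) scaleR_sum_right)
  moreover have "\<forall>u\<in>F. 0 \<le> a * c u"
    using F(3) assms(2) by simp
  ultimately show ?thesis
    unfolding nonneg_combinations_def using F(1,2)
    by (intro CollectI exI[of _ F] exI[of _ "\<lambda>u. a * c u"]) simp
qed

lemma sum_in_nonneg_combinations:
  assumes "\<And>i. i \<in> I \<Longrightarrow> v i \<in> nonneg_combinations S"
  shows "(\<Sum>i\<in>I. v i) \<in> nonneg_combinations S"
  using assms
  by (induction I rule: infinite_finite_induct)
    (auto intro: zero_in_nonneg_combinations add_in_nonneg_combinations)

text \<open>
  The vectors \<open>b\<close> and \<open>- b\<close>, for \<open>b\<close> in an orthonormal basis, each use finitely many
  elements of a positive basis. All elements used in this way already span positively, so minimality
  leaves no others.
\<close>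

lemma positive_basis_finite:
  fixes D :: "'a::euclidean_space set"
  assumes "positive_basis D"
  shows "finite D"
proof -
  have span: "v \<in> nonneg_combinations D" for v
    using assms unfolding positive_basis_def by blast
  have "\<exists>F. finite F \<and> F \<subseteq> D \<and> v \<in> nonneg_combinations F" for v
    using span[of v] unfolding nonneg_combinations_def by blast
  then obtain F where F: "\<And>v. finite (F v)" "\<And>v. F v \<subseteq> D" "\<And>v. v \<in> nonneg_combinations (F v)"
    by metis
  define E where "E = (\<Union>b\<in>Basis. F b \<union> F (- b))"
  have mono: "nonneg_combinations A \<subseteq> nonneg_combinations B" if "A \<subseteq> B" for A B :: "'a set"
    using that unfolding nonneg_combinations_def by blast
  have basis: "b \<in> nonneg_combinations E" "- b \<in> nonneg_combinations E" if "b \<in> Basis" for b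
    using that F(3) mono[of "F b" E] mono[of "F (- b)" E] unfolding E_def by blast+
  have "v \<in> nonneg_combinations E" for v
  proof -
    \<comment> \<open>Each coordinate is split into its positive and negative parts.\<close>
    have "(v \<bullet> b) *\<^sub>R b = max (v \<bullet> b) 0 *\<^sub>R b + max (- (v \<bullet> b)) 0 *\<^sub>R (- b)" for b
      by (simp add: max_def)
    then have "v = (\<Sum>b\<in>Basis. max (v \<bullet> b) 0 *\<^sub>R b + max (- (v \<bullet> b)) 0 *\<^sub>R (- b))"
      by (metis (no_types, lifting) euclidean_representation sum.cong)
    also have "\<dots> \<in> nonneg_combinations E"
      by (intro sum_in_nonneg_combinations add_in_nonneg_combinations
          scale_in_nonneg_combinations basis) auto
    finally show ?thesis .
  qed
  then have "nonneg_combinations E = UNIV"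
    by blast
  moreover have "E \<subseteq> D"
    unfolding E_def using F(2) by blast
  ultimately have "E = D"
    using assms unfolding positive_basis_def by blast
  moreover have "finite E"
    unfolding E_def using F(1) by simp
  ultimately show ?thesis
    by simp
qed

section \<open>Lattices, sequences and ample sets\<close>

lemma finite_integer_vectors_in_bounded:
  fixes B :: "(real ^ 'n) set"
  assumes "bounded B"
  shows "finite {z \<in> B. \<forall>i. z $ i \<in> \<int>}"
proof -
  obtain b where b: "\<And>z. z \<in> B \<Longrightarrow> norm z \<le> b"
    using assms unfolding bounded_iff by blast
  let ?A = "{k::real. k \<in> \<int> \<and> \<bar>k\<bar> \<le> b}"
  have "{z \<in> B. \<forall>i. z $ i \<in> \<int>} \<subseteq> vec_lambda ` (UNIV \<rightarrow>\<^sub>E ?A)"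
  proof
    fix z assume z: "z \<in> {z \<in> B. \<forall>i. z $ i \<in> \<int>}"
    have "\<bar>z $ i\<bar> \<le> b" for i
      using component_le_norm_cart[of z i] b[of z] z by auto
    then have "vec_nth z \<in> UNIV \<rightarrow>\<^sub>E ?A"
      using z by auto
    then show "z \<in> vec_lambda ` (UNIV \<rightarrow>\<^sub>E ?A)"
      by (rule image_eqI[rotated]) simp
  qed
  moreover have "finite (vec_lambda ` (UNIV \<rightarrow>\<^sub>E ?A) :: (real ^ 'n) set)"
    by (intro finite_imageI finite_PiE finite_abs_int_segment) simp
  ultimately show ?thesis
    by (rule finite_subset)
qed

lemma lattice_points_finite_range:
  fixes x :: "nat \<Rightarrow> real ^ 'n"
  assumes "a \<noteq> 0" and "bounded (x ` I)"
    and lattice: "\<And>k. k \<in> I \<Longrightarrow> \<exists>z. (\<forall>i. z $ i \<in> \<int>) \<and> x k = p + a *\<^sub>R z"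
  shows "finite (x ` I)"
proof -
  let ?B = "(\<lambda>y. inverse a *\<^sub>R (y - p)) ` x ` I"
  have "bounded ((\<lambda>y. - p + y) ` x ` I)"
    by (rule bounded_translation[OF assms(2)])
  then have "bounded ((\<lambda>y. inverse a *\<^sub>R y) ` (\<lambda>y. - p + y) ` x ` I)"
    by (rule bounded_scaling)
  then have "bounded ?B"
    by (simp add: image_image)
  then have fin: "finite {z \<in> ?B. \<forall>i. z $ i \<in> \<int>}"
    by (rule finite_integer_vectors_in_bounded)
  have "x ` I \<subseteq> (\<lambda>z. p + a *\<^sub>R z) ` {z \<in> ?B. \<forall>i. z $ i \<in> \<int>}"
  proof
    fix y assume "y \<in> x ` I"
    then obtain k where k: "k \<in> I" "y = x k"
      by blast
    obtain z where z: "\<forall>i. z $ i \<in> \<int>" "x k = p + a *\<^sub>R z"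
      using lattice[OF k(1)] by blast
    have "z = inverse a *\<^sub>R (x k - p)"
      using z(2) \<open>a \<noteq> 0\<close> by simp
    then show "y \<in> (\<lambda>z. p + a *\<^sub>R z) ` {z \<in> ?B. \<forall>i. z $ i \<in> \<int>}"
      using z k by blast
  qed
  then show ?thesis
    using fin finite_surj by blast
qed

lemma enumerate_range_strict_mono:
  fixes e :: "nat \<Rightarrow> nat"
  assumes "strict_mono e"
  shows "enumerate (range e) = e"
proof
  have inf: "infinite (range e)"
    using assms by (simp add: range_inj_infinite strict_mono_imp_inj_on)
  fix n show "enumerate (range e) n = e n"
  proof (induction n)
    case 0
    have "e 0 \<le> e m" for m
      using assms by (simp add: strict_mono_less_eq)
    then show ?case
      by (simp only: enumerate_0) (rule Least_equality, auto)
  next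
    case (Suc n)
    have "e (Suc n) \<le> e m" if "e n < e m" for m
      using that assms by (simp add: strict_mono_less strict_mono_less_eq)
    then show ?case
      unfolding enumerate_Suc''[OF inf] Suc.IH
      using assms by (intro Least_equality) (auto simp: strict_mono_less)
  qed
qed

lemma filterlim_enumerate:
  assumes "infinite (K :: nat set)"
  shows "filterlim (enumerate K) sequentially sequentially"
  using assms by (simp add: filterlim_subseq strict_mono_enumerate)

text \<open>
  This excludes both infinitely many decreases of \<open>f\<close> by a fixed amount and infinitely many
  reductions by a fixed factor of a radius that stays away from \<open>0\<close>.
\<close>

lemma finite_large_decrements:
  fixes a :: "nat \<Rightarrow> real"
  assumes "a \<longlonglongrightarrow> l" and "0 < \<eta>"
  shows "finite {k. \<eta> \<le> a k - a (Suc k)}"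
proof -
  have "(\<lambda>k. a k - a (Suc k)) \<longlonglongrightarrow> l - l"
    by (intro tendsto_diff assms(1) LIMSEQ_Suc)
  then have "\<forall>\<^sub>F k in sequentially. a k - a (Suc k) < \<eta>"
    using assms(2) by (intro order_tendstoD) auto
  then obtain n where "\<And>k. n \<le> k \<Longrightarrow> a k - a (Suc k) < \<eta>"
    unfolding eventually_sequentially by blast
  then have "{k. \<eta> \<le> a k - a (Suc k)} \<subseteq> {..<n}"
    by (force simp: not_less[symmetric])
  then show ?thesis
    by (rule finite_subset) simp
qed

text \<open>
  Continuity on \<open>S\<close> controls \<open>f\<close> near \<open>y\<close> only inside \<open>S\<close>, a set that need not
  contain a neighbourhood of \<open>y\<close>; ampleness supplies interior points of \<open>S\<close> that are
  close enough to \<open>y\<close>.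
\<close>

lemma open_set_below_on_ample:
  fixes f :: "'a::topological_space \<Rightarrow> real"
  assumes "open B" "y \<in> B" "y \<in> S" "ample S" "continuous_on S f" "f y < c"
  obtains U where "open U" "U \<noteq> {}" "U \<subseteq> B" "U \<subseteq> S" "\<And>u. u \<in> U \<Longrightarrow> f u < c"
proof -
  have "\<exists>A. open A \<and> A \<inter> S = f -` {..<c} \<inter> S"
    using assms(5) open_lessThan[of c] unfolding continuous_on_open_invariant by blast
  then obtain A where A: "open A" "A \<inter> S = f -` {..<c} \<inter> S"
    by blast
  have "y \<in> A \<inter> B"
    using A(2) assms(2,3,6) by blast
  moreover have "y \<in> closure (interior S)"
    using assms(3,4) unfolding ample_def by blast
  ultimately have "A \<inter> B \<inter> interior S \<noteq> {}"
    using A(1) assms(1) by (metis disjoint_iff open_Int open_Int_closure_eq_empty)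
  moreover have "f u < c" if "u \<in> A \<inter> B \<inter> interior S" for u
    using that A(2) interior_subset[of S] by blast
  ultimately show ?thesis
    using that[of "A \<inter> B \<inter> interior S"] A(1) assms(1) interior_subset[of S] by blast
qed

section \<open>One iteration of the method\<close>

lemma argmin_on_iff:
  "argmin_on f S t \<longleftrightarrow> t \<in> S \<and> (\<forall>s\<in>S. f t \<le> f s)"
  unfolding argmin_on_def is_arg_min_linorder by auto

text \<open>
  A step is reached only if the earlier steps found no value below the acceptance threshold, which
  an accepted point undercuts. Therefore an accepted point is a minimizer over all trial points, not
  only over those of its own step.
\<close>

lemma iteration_fails_or_decreases:
  assumes "cdsm_iteration N f r M \<rho> x \<delta> \<nu> t T"
  shows "finite T" and
    "(t = x \<and> (\<forall>h\<in>T. f x - ereal (\<rho> \<nu>) \<le> f h)) \<or>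
     (f t < f x - ereal (\<rho> \<nu>) \<and> (\<forall>h\<in>T. f t \<le> f h) \<and> t - x \<in> M \<nu>)"
proof -
  let ?th = "f x - ereal (\<rho> \<nu>)"
  let ?step = "(t = x \<and> (\<forall>h\<in>T. ?th \<le> f h)) \<or>
     (f t < ?th \<and> (\<forall>h\<in>T. f t \<le> f h) \<and> t - x \<in> M \<nu>)"
  obtain D\<^sub>C T\<^sub>C t\<^sub>C T\<^sub>S T\<^sub>P where T: "T = T\<^sub>C \<union> T\<^sub>S \<union> T\<^sub>P"
    and C: "D\<^sub>C \<subseteq> M \<nu>" "finite D\<^sub>C" "T\<^sub>C = (\<lambda>d. x + d) ` D\<^sub>C" "argmin_on f T\<^sub>C t\<^sub>C"
    and rest: "if f t\<^sub>C < ?th then t = t\<^sub>C \<and> T\<^sub>S = {} \<and> T\<^sub>P = {}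
         else (\<exists>D\<^sub>S t\<^sub>S.
           D\<^sub>S \<subseteq> M \<nu> \<and> finite D\<^sub>S \<and> T\<^sub>S = (\<lambda>d. x + d) ` D\<^sub>S \<and>
           (T\<^sub>S \<noteq> {} \<longrightarrow> argmin_on f T\<^sub>S t\<^sub>S) \<and>
           (if T\<^sub>S \<noteq> {} \<and> f t\<^sub>S < ?th then t = t\<^sub>S \<and> T\<^sub>P = {}
            else (\<exists>D\<^sub>P t\<^sub>P.
              D\<^sub>P \<subseteq> M \<nu> \<inter> closure (norm_ball N \<delta> 0) \<and> positive_basis D\<^sub>P \<and>
              T\<^sub>P = (\<lambda>d. x + d) ` D\<^sub>P \<and> argmin_on f T\<^sub>P t\<^sub>P \<and>
              t = (if f t\<^sub>P < ?th then t\<^sub>P else x))))"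
    using assms unfolding cdsm_iteration_def Int_subset_iff by blast
  have tC: "t\<^sub>C - x \<in> M \<nu>" "\<And>h. h \<in> T\<^sub>C \<Longrightarrow> f t\<^sub>C \<le> f h"
    using C unfolding argmin_on_iff by auto
  have finC: "finite T\<^sub>C"
    using C by simp
  have "finite T \<and> ?step"
  proof (cases "f t\<^sub>C < ?th")
    case True
    then show ?thesis
      using rest T tC finC by auto
  next
    case nC: False
    then obtain D\<^sub>S t\<^sub>S where S: "D\<^sub>S \<subseteq> M \<nu>" "finite D\<^sub>S" "T\<^sub>S = (\<lambda>d. x + d) ` D\<^sub>S"
        "T\<^sub>S \<noteq> {} \<Longrightarrow> argmin_on f T\<^sub>S t\<^sub>S"
      and rest2: "if T\<^sub>S \<noteq> {} \<and> f t\<^sub>S < ?th then t = t\<^sub>S \<and> T\<^sub>P = {}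
            else (\<exists>D\<^sub>P t\<^sub>P.
              D\<^sub>P \<subseteq> M \<nu> \<inter> closure (norm_ball N \<delta> 0) \<and> positive_basis D\<^sub>P \<and>
              T\<^sub>P = (\<lambda>d. x + d) ` D\<^sub>P \<and> argmin_on f T\<^sub>P t\<^sub>P \<and>
              t = (if f t\<^sub>P < ?th then t\<^sub>P else x))"
      using rest by auto
    have aboveC: "?th \<le> f h" if "h \<in> T\<^sub>C" for h
      using tC(2)[OF that] nC by auto
    have tS: "h \<in> T\<^sub>S \<Longrightarrow> f t\<^sub>S \<le> f h" for h
      using S(4) unfolding argmin_on_iff by auto
    have finS: "finite T\<^sub>S"
      using S by simp
    show ?thesis
    proof (cases "T\<^sub>S \<noteq> {} \<and> f t\<^sub>S < ?th")
      case True
      then have "t\<^sub>S \<in> T\<^sub>S"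
        using S(4) unfolding argmin_on_iff by auto
      then have "t\<^sub>S - x \<in> M \<nu>"
        using S by auto
      moreover have "f t\<^sub>S \<le> f h" if "h \<in> T\<^sub>C" for h
        using aboveC[OF that] True by (meson less_imp_le order_trans)
      ultimately show ?thesis
        using True rest2 T tS finC finS by auto
    next
      case nS: False
      then obtain D\<^sub>P t\<^sub>P where P: "D\<^sub>P \<subseteq> M \<nu>" "positive_basis D\<^sub>P" "T\<^sub>P = (\<lambda>d. x + d) ` D\<^sub>P"
          "argmin_on f T\<^sub>P t\<^sub>P" "t = (if f t\<^sub>P < ?th then t\<^sub>P else x)"
        using rest2 by (metis Int_subset_iff)
      have aboveS: "?th \<le> f h" if "h \<in> T\<^sub>S" for h
        using tS[OF that] nS that by auto
      have tP: "t\<^sub>P - x \<in> M \<nu>" "\<And>h. h \<in> T\<^sub>P \<Longrightarrow> f t\<^sub>P \<le> f h"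
        using P unfolding argmin_on_iff by auto
      have "finite T"
        using T P(2,3) finC finS by (simp add: positive_basis_finite)
      moreover have ?step
      proof (cases "f t\<^sub>P < ?th")
        case True
        then have "f t\<^sub>P \<le> f h" if "h \<in> T\<^sub>C \<union> T\<^sub>S" for h
          using that aboveC aboveS by (metis UnE less_imp_le order_trans)
        then show ?thesis
          using True P(5) T tP by auto
      next
        case False
        then have "?th \<le> f h" if "h \<in> T\<^sub>P" for h
          using tP(2)[OF that] by auto
        then show ?thesis
          using False P(5) T aboveC aboveS by auto
      qed
      ultimately show ?thesis
        by blast
    qed
  qed
  then show "finite T" and ?step
    by blast+
qed

section \<open>Runs on a coercive objective\<close>

locale coercive_cdsm_run =
  fixes N :: "real ^ 'n \<Rightarrow> real"
    and f :: "real ^ 'n \<Rightarrow> ereal"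
    and r \<tau> :: real
    and M :: "real \<Rightarrow> (real ^ 'n) set"
    and \<rho> :: "real \<Rightarrow> real"
    and x :: "nat \<Rightarrow> real ^ 'n"
    and \<delta> \<nu> :: "nat \<Rightarrow> real"
    and H :: "nat \<Rightarrow> (real ^ 'n) set"
  assumes not_minus_infinity: "f y \<noteq> -\<infinity>"
    and bounded_below: "\<exists>c::real. \<forall>y. ereal c \<le> f y"
    and bounded_sublevels: "\<And>a::real. bounded {y. f y \<le> ereal a}"
    and run: "cdsm_run N f r \<tau> M \<rho> x \<delta> \<nu> H"
begin

definition val :: "nat \<Rightarrow> real" where
  "val k = real_of_ereal (f (x k))"

definition success :: "nat \<Rightarrow> bool" where
  "success k \<longleftrightarrow> x (Suc k) \<noteq> x k"

lemma init:
  "0 < r" "H 0 = {}" "f (x 0) \<noteq> \<infinity>" "0 < \<delta> 0" "\<nu> 0 = \<delta> 0" "0 < \<tau>" "\<tau> < 1"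
  and modes: "mesh_based (\<delta> 0) M \<rho> \<or> sufficient_decrease_based (\<delta> 0) M \<rho>"
  using run unfolding cdsm_run_def edom_def by auto

lemma iteration:
  obtains T where "cdsm_iteration N f r M \<rho> (x k) (\<delta> k) (\<nu> k) (x (Suc k)) T"
    "H (Suc k) = H k \<union> T"
  using run unfolding cdsm_run_def by blast

lemma radius_Suc: "\<delta> (Suc k) = (if success k then \<delta> k / \<tau> else \<tau> * \<delta> k)"
  and min_radius_Suc: "\<nu> (Suc k) = min (\<nu> k) (\<delta> (Suc k))"
  using run unfolding cdsm_run_def success_def by blast+

lemma rho_bounds:
  assumes "0 \<le> v"
  shows "0 \<le> \<rho> v" "\<rho> v \<le> v"
  using modes assms init(4) unfolding mesh_based_def sufficient_decrease_based_def
  by (auto simp: min_def)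

lemma le_divide_power: "0 < v \<Longrightarrow> v \<le> v / \<tau> ^ j"
  using init(6,7) by (simp add: pos_le_divide_eq mult_left_le power_le_one)

text \<open>
  A success multiplies \<open>\<delta>\<close> by \<open>1 / \<tau>\<close> and a failure by \<open>\<tau>\<close>, so \<open>\<delta>\<close> cannot
  cross its running minimum \<open>\<nu>\<close> without first being equal to it.
\<close>

lemma radius_as_power: "0 < \<nu> k \<and> (\<exists>i. \<delta> k = \<nu> k / \<tau> ^ i)"
proof (induction k)
  case 0
  show ?case
    using init(4,5) by (auto intro: exI[of _ 0])
next
  case (Suc k)
  then obtain i where i: "0 < \<nu> k" "\<delta> k = \<nu> k / \<tau> ^ i"
    by blast
  then have ge: "\<nu> k \<le> \<nu> k / \<tau> ^ j" for j
    by (intro le_divide_power)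
  show ?case
  proof (cases "success k")
    case True
    then have "\<delta> (Suc k) = \<nu> k / \<tau> ^ Suc i"
      by (simp add: radius_Suc i(2) mult.commute)
    then show ?thesis
      using ge[of "Suc i"] i(1) unfolding min_radius_Suc by (metis min.absorb1)
  next
    case False
    show ?thesis
    proof (cases i)
      case 0
      then have "\<delta> (Suc k) = \<tau> * \<nu> k"
        using False i(2) by (simp add: radius_Suc)
      moreover have "\<tau> * \<nu> k < \<nu> k"
        using i(1) init(7) by simp
      ultimately show ?thesis
        using i(1) init(6) by (auto simp: min_radius_Suc intro: exI[of _ 0])
    next
      case (Suc j)
      then have "\<delta> (Suc k) = \<nu> k / \<tau> ^ j"
        using False i(2) init(6) by (simp add: radius_Suc)
      then show ?thesis
        using ge[of j] i(1) unfolding min_radius_Suc by (metis min.absorb1)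
    qed
  qed
qed

lemma min_radius_pos: "0 < \<nu> k"
  using radius_as_power by blast

lemma min_radius_le_radius: "\<nu> k \<le> \<delta> k"
  using init(5) by (cases k) (auto simp: min_radius_Suc)

lemma min_radius_drop:
  assumes "\<nu> (Suc k) \<noteq> \<nu> k"
  shows "\<not> success k" "\<delta> k = \<nu> k" "\<nu> (Suc k) = \<tau> * \<nu> k"
proof -
  obtain i where i: "\<delta> k = \<nu> k / \<tau> ^ i"
    using radius_as_power by blast
  have less: "\<delta> (Suc k) < \<nu> k"
    using assms unfolding min_radius_Suc by auto
  have ge: "\<nu> k \<le> \<nu> k / \<tau> ^ j" for j
    using min_radius_pos by (rule le_divide_power)
  show fail: "\<not> success k"
  proof
    assume "success k"
    then have "\<delta> (Suc k) = \<nu> k / \<tau> ^ Suc i"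
      by (simp add: radius_Suc i mult.commute)
    with ge[of "Suc i"] less show False
      by simp
  qed
  have "i = 0"
  proof (cases i)
    case (Suc j)
    then have "\<delta> (Suc k) = \<nu> k / \<tau> ^ j"
      using fail i init(6) by (simp add: radius_Suc)
    with ge[of j] less show ?thesis
      by simp
  qed
  then show "\<delta> k = \<nu> k"
    using i by simp
  then show "\<nu> (Suc k) = \<tau> * \<nu> k"
    using fail less by (simp add: min_radius_Suc radius_Suc)
qed

lemma fails_or_decreases:
  "(x (Suc k) = x k \<and> (\<forall>h\<in>H (Suc k) - H k. f (x k) - ereal (\<rho> (\<nu> k)) \<le> f h)) \<or>
   (f (x (Suc k)) < f (x k) - ereal (\<rho> (\<nu> k)) \<and> (\<forall>h\<in>H (Suc k) - H k. f (x (Suc k)) \<le> f h) \<and>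
    x (Suc k) - x k \<in> M (\<nu> k))"
proof -
  obtain T where T: "cdsm_iteration N f r M \<rho> (x k) (\<delta> k) (\<nu> k) (x (Suc k)) T"
    "H (Suc k) = H k \<union> T"
    by (rule iteration)
  then have "H (Suc k) - H k \<subseteq> T"
    by blast
  then show ?thesis
    using iteration_fails_or_decreases(2)[OF T(1)] by blast
qed

lemma finite_history: "finite (H k)"
proof (induction k)
  case (Suc k)
  then show ?case
    using iteration[of k] iteration_fails_or_decreases(1) by (metis finite_UnI)
qed (simp add: init)

lemma incumbent_value: "f (x k) = ereal (val k)"
proof -
  have "f (x k) \<noteq> \<infinity>"
  proof (induction k)
    case (Suc k)
    have "f (x (Suc k)) \<noteq> \<infinity>" if "f (x (Suc k)) < f (x k) - ereal (\<rho> (\<nu> k))"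
      using that by auto
    then show ?case
      using fails_or_decreases[of k] Suc by auto
  qed (rule init)
  then show ?thesis
    unfolding val_def using not_minus_infinity[of "x k"] by (cases "f (x k)") auto
qed

lemma val_success:
  assumes "success k"
  shows "val (Suc k) < val k - \<rho> (\<nu> k)" "x (Suc k) - x k \<in> M (\<nu> k)"
  using fails_or_decreases[of k] assms unfolding success_def incumbent_value by auto

lemma rho_min_radius_nonneg: "0 \<le> \<rho> (\<nu> k)"
  using rho_bounds(1) min_radius_pos less_imp_le by blast

lemma val_decseq: "decseq val"
proof (rule decseq_SucI)
  fix k show "val (Suc k) \<le> val k"
  proof (cases "success k")
    case True
    then show ?thesis
      using val_success(1)[of k] rho_min_radius_nonneg[of k] by linarith
  qed (simp add: success_def val_def)
qed

definition val_lim :: real where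
  "val_lim = lim val"

lemma val_tendsto: "val \<longlonglongrightarrow> val_lim"
  and val_lim_le: "val_lim \<le> val k"
proof -
  obtain c :: real where c: "\<And>y. ereal c \<le> f y"
    using bounded_below by blast
  have "\<forall>k. c \<le> val k"
    using c incumbent_value by (metis ereal_less_eq(3))
  then obtain l where l: "val \<longlonglongrightarrow> l" "\<forall>k. l \<le> val k"
    using decseq_convergent[OF val_decseq] by blast
  moreover have "val_lim = l"
    unfolding val_lim_def using l(1) by (rule limI)
  ultimately show "val \<longlonglongrightarrow> val_lim" and "val_lim \<le> val k"
    by auto
qed

lemma bounded_incumbents: "bounded (range x)"
proof (rule bounded_subset[OF bounded_sublevels[of "val 0"]])
  show "range x \<subseteq> {y. f y \<le> ereal (val 0)}"
    using val_decseq by (auto simp: incumbent_value decseq_def)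
qed

section \<open>The radii tend to zero and refining subsequences exist\<close>

text \<open>
  With \<open>\<nu>\<close> fixed, successes would stay on one lattice or lower the values by a fixed
  amount. In the first case they have distinct values at finitely many points; in the second case
  the convergence of the values bounds their number.
\<close>

lemma finitely_many_successes_if_min_radius_constant:
  assumes const: "\<And>k. n \<le> k \<Longrightarrow> \<nu> k = c"
  shows "finite {k. success k}"
proof -
  have "0 < c"
    using const[of n] min_radius_pos[of n] by simp
  define a where "a = min c (c\<^sup>2 / \<delta> 0)"
  have "0 < a"
    unfolding a_def using \<open>0 < c\<close> init(4) by simp
  let ?S = "{k. n \<le> k \<and> success k}"
  have "finite ?S"
    using modes
  proof
    assume mesh: "mesh_based (\<delta> 0) M \<rho>"
    have Mc: "M c = (\<lambda>z. a *\<^sub>R z) ` {z. \<forall>i. z $ i \<in> \<int>}"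
      using mesh \<open>0 < c\<close> unfolding mesh_based_def a_def by simp
    have "\<exists>z. (\<forall>i. z $ i \<in> \<int>) \<and> x k = x n + a *\<^sub>R z" if "n \<le> k" for k
      using that
    proof (induction k rule: dec_induct)
      case base
      show ?case
        by (rule exI[of _ 0]) simp
    next
      case (step k)
      then obtain z where z: "\<forall>i. z $ i \<in> \<int>" "x k = x n + a *\<^sub>R z"
        by blast
      show ?case
      proof (cases "success k")
        case True
        then obtain w where w: "\<forall>i. w $ i \<in> \<int>" "x (Suc k) - x k = a *\<^sub>R w"
          using val_success(2)[OF True] const[OF step(1)] Mc by auto
        have "x (Suc k) = x n + a *\<^sub>R (z + w)"
          using z(2) w(2) by (simp add: algebra_simps)
        moreover have "\<forall>i. (z + w) $ i \<in> \<int>"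
          using z(1) w(1) by simp
        ultimately show ?thesis
          by blast
      next
        case False
        then show ?thesis
          using z by (auto simp: success_def)
      qed
    qed
    moreover have "bounded (x ` {n..})"
      using bounded_incumbents by (rule bounded_subset) auto
    ultimately have "finite (x ` {n..})"
      using \<open>0 < a\<close> by (intro lattice_points_finite_range[of a _ _ "x n"]) auto
    then have "finite ((\<lambda>y. real_of_ereal (f y)) ` x ` {n..})"
      by (rule finite_imageI)
    then have "finite (val ` ?S)"
      by (rule finite_subset[rotated]) (auto simp: val_def)
    moreover have "inj_on val ?S"
    proof (rule linorder_inj_onI)
      fix k l assume kl: "k < l" "k \<in> ?S" "l \<in> ?S"
      have "val (Suc k) < val k"
        using val_success(1)[of k] rho_min_radius_nonneg[of k] kl(2) by simp
      moreover have "val l \<le> val (Suc k)"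
        using val_decseq kl(1) by (simp add: decseq_def)
      ultimately show "val k \<noteq> val l"
        by simp
    qed auto
    ultimately show ?thesis
      by (rule finite_imageD)
  next
    assume "sufficient_decrease_based (\<delta> 0) M \<rho>"
    then have "\<rho> c = a"
      using \<open>0 < c\<close> unfolding sufficient_decrease_based_def a_def by simp
    then have "?S \<subseteq> {k. a \<le> val k - val (Suc k)}"
      using val_success(1) const by force
    then show ?thesis
      using finite_large_decrements[OF val_tendsto \<open>0 < a\<close>] finite_subset by blast
  qed
  then have "finite (?S \<union> {..<n})"
    by simp
  then show ?thesis
    by (rule finite_subset[rotated]) auto
qed

lemma infinitely_many_drops: "infinite {k. \<nu> (Suc k) \<noteq> \<nu> k}"
proof
  assume "finite {k. \<nu> (Suc k) \<noteq> \<nu> k}"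
  then obtain n where n: "\<And>k. n \<le> k \<Longrightarrow> \<nu> (Suc k) = \<nu> k"
    unfolding finite_nat_set_iff_bounded by (auto simp: not_le[symmetric])
  have const: "\<nu> k = \<nu> n" if "n \<le> k" for k
    using that by (induction k rule: dec_induct) (auto simp: n)
  have "finite {k. success k}"
    using const by (rule finitely_many_successes_if_min_radius_constant)
  then obtain l where l: "\<And>k. l \<le> k \<Longrightarrow> \<not> success k"
    unfolding finite_nat_set_iff_bounded by (auto simp: not_le[symmetric])
  have "\<delta> (l + j) = \<tau> ^ j * \<delta> l" for j
    by (induction j) (simp_all add: radius_Suc l)
  moreover have "(\<lambda>j. \<tau> ^ j * \<delta> l) \<longlonglongrightarrow> 0 * \<delta> l"
    using init(6,7) by (intro tendsto_mult LIMSEQ_power_zero tendsto_const) auto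
  ultimately have "(\<lambda>j. \<delta> (l + j)) \<longlonglongrightarrow> 0"
    by simp
  then have "\<forall>\<^sub>F j in sequentially. \<delta> (l + j) < \<nu> n"
    by (rule order_tendstoD) (rule min_radius_pos)
  then obtain j where "n \<le> j" "\<delta> (l + j) < \<nu> n"
    unfolding eventually_sequentially by (meson nat_le_linear)
  then show False
    using const[of "l + j"] min_radius_le_radius[of "l + j"] by simp
qed

lemma min_radius_tendsto_zero: "\<nu> \<longlonglongrightarrow> 0"
proof -
  have "decseq \<nu>"
    by (rule decseq_SucI) (simp add: min_radius_Suc)
  then obtain l where l: "\<nu> \<longlonglongrightarrow> l" "\<forall>k. l \<le> \<nu> k"
    by (rule decseq_convergent[of \<nu> 0]) (auto intro: less_imp_le min_radius_pos)
  have "l \<le> 0"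
  proof (rule ccontr)
    assume "\<not> l \<le> 0"
    then have "0 < (1 - \<tau>) * l"
      using init(7) by simp
    with l(1) have "finite {k. (1 - \<tau>) * l \<le> \<nu> k - \<nu> (Suc k)}"
      by (rule finite_large_decrements)
    moreover have "{k. \<nu> (Suc k) \<noteq> \<nu> k} \<subseteq> {k. (1 - \<tau>) * l \<le> \<nu> k - \<nu> (Suc k)}"
    proof safe
      fix k assume "\<nu> (Suc k) \<noteq> \<nu> k"
      then have "\<nu> k - \<nu> (Suc k) = (1 - \<tau>) * \<nu> k"
        using min_radius_drop(3) by (simp add: algebra_simps)
      then show "(1 - \<tau>) * l \<le> \<nu> k - \<nu> (Suc k)"
        using l(2) init(7) by (simp add: mult_left_mono)
    qed
    ultimately show False
      using infinitely_many_drops finite_subset by blast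
  qed
  moreover have "0 \<le> l"
    using l(1) min_radius_pos by (intro LIMSEQ_le_const) (auto intro: less_imp_le)
  ultimately show ?thesis
    using l(1) by simp
qed

lemma refining_subsequence_exists: "\<exists>K xs. indexes_refining x \<delta> K xs"
proof -
  \<comment> \<open>At a drop the iteration fails and \<open>\<delta>\<close> equals \<open>\<nu>\<close>, so \<open>\<delta>\<close> tends to \<open>0\<close> along the drops.\<close>
  let ?L = "{k. \<nu> (Suc k) \<noteq> \<nu> k}"
  let ?e = "enumerate ?L"
  have e: "strict_mono ?e" "\<And>j. ?e j \<in> ?L"
    using infinitely_many_drops by (auto simp: strict_mono_enumerate dest: enumerate_in_set)
  have "bounded (range (x \<circ> ?e))"
    using bounded_incumbents by (rule bounded_subset) auto
  then obtain xs s where s: "strict_mono s" "((x \<circ> ?e) \<circ> s) \<longlonglongrightarrow> xs"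
    using bounded_imp_convergent_subsequence by blast
  let ?K = "range (?e \<circ> s)"
  have mono: "strict_mono (?e \<circ> s)"
    using e(1) s(1) by (rule strict_mono_o)
  have enum: "enumerate ?K = ?e \<circ> s"
    using mono by (rule enumerate_range_strict_mono)
  have "infinite ?K"
    using strict_mono_imp_inj_on[OF mono] by (rule range_inj_infinite)
  moreover have "\<forall>k\<in>?K. x (Suc k) = x k"
    using e(2) min_radius_drop(1) unfolding success_def by auto
  moreover have "\<delta> \<circ> (?e \<circ> s) = \<nu> \<circ> (?e \<circ> s)"
    using e(2) min_radius_drop(2) by auto
  then have "(\<delta> \<circ> enumerate ?K) \<longlonglongrightarrow> 0"
    unfolding enum using LIMSEQ_subseq_LIMSEQ[OF min_radius_tendsto_zero mono] by simp
  moreover have "(x \<circ> enumerate ?K) \<longlonglongrightarrow> xs"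
    unfolding enum using s(2) by (simp add: comp_assoc)
  ultimately show ?thesis
    unfolding indexes_refining_def by blast
qed

section \<open>The limit value is optimal on the ball\<close>

text \<open>
  A trial point of a failed iteration misses the acceptance threshold, which lies \<open>\<rho> (\<nu> k)\<close>
  below an incumbent value; a trial point of a successful one is no better than the next
  incumbent. All incumbent values are at least \<open>val_lim\<close>.
\<close>

lemma trial_value_ge:
  assumes "h \<in> H (Suc k) - H k"
  shows "ereal (val_lim - \<rho> (\<nu> k)) \<le> f h"
  using fails_or_decreases[of k]
proof
  assume "x (Suc k) = x k \<and> (\<forall>h\<in>H (Suc k) - H k. f (x k) - ereal (\<rho> (\<nu> k)) \<le> f h)"
  then have "ereal (val k - \<rho> (\<nu> k)) \<le> f h"
    using assms by (auto simp: incumbent_value)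
  moreover have "ereal (val_lim - \<rho> (\<nu> k)) \<le> ereal (val k - \<rho> (\<nu> k))"
    using val_lim_le by simp
  ultimately show ?thesis
    by (rule order_trans[rotated])
next
  assume "f (x (Suc k)) < f (x k) - ereal (\<rho> (\<nu> k)) \<and>
    (\<forall>h\<in>H (Suc k) - H k. f (x (Suc k)) \<le> f h) \<and> x (Suc k) - x k \<in> M (\<nu> k)"
  then have "ereal (val (Suc k)) \<le> f h"
    using assms by (auto simp: incumbent_value)
  moreover have "ereal (val_lim - \<rho> (\<nu> k)) \<le> ereal (val (Suc k))"
    using val_lim_le[of "Suc k"] rho_min_radius_nonneg[of k] by simp
  ultimately show ?thesis
    by (rule order_trans[rotated])
qed

lemma new_trial_at_some_iteration:
  assumes "h \<in> H j" "h \<notin> H n"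
  obtains k where "n \<le> k" "h \<in> H (Suc k) - H k"
proof -
  have mono: "H i \<subseteq> H (Suc i)" for i
    using iteration[of i] by blast
  have "n \<le> j"
    using assms lift_Suc_mono_le[of H j n] mono by (meson nat_le_linear subsetD)
  have "\<exists>k\<ge>n. h \<in> H (Suc k) - H k"
    using \<open>n \<le> j\<close> assms
  proof (induction j rule: dec_induct)
    case (step j)
    then show ?case
      by blast
  qed simp
  then show ?thesis
    using that by blast
qed

text \<open>
  The finitely many points evaluated in early iterations, where \<open>\<rho> (\<nu> k)\<close> may still be large,
  are removed from \<open>U\<close>; a nonempty open set remains, since finite sets have empty interior.
\<close>

lemma late_trial_point:
  assumes "open U" "U \<noteq> {}" "U \<subseteq> closure (\<Union>k. H k)" "0 < \<epsilon>"
  obtains h where "h \<in> U" "ereal (val_lim - \<epsilon>) \<le> f h"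
proof -
  have "\<forall>\<^sub>F k in sequentially. \<nu> k < \<epsilon>"
    using min_radius_tendsto_zero assms(4) by (rule order_tendstoD)
  then obtain n where n: "\<And>k. n \<le> k \<Longrightarrow> \<nu> k < \<epsilon>"
    unfolding eventually_sequentially by blast
  have "open (U - H n)"
    using assms(1) finite_history by (simp add: open_Diff finite_imp_closed)
  moreover have "U - H n \<noteq> {}"
    using finite_imp_not_open[of U] assms(1,2) finite_history[of n] finite_subset[of U "H n"]
    by blast
  ultimately have "(U - H n) \<inter> (\<Union>k. H k) \<noteq> {}"
    using assms(3) open_Int_closure_eq_empty[of "U - H n" "\<Union>k. H k"] by blast
  then obtain h j where h: "h \<in> U" "h \<notin> H n" "h \<in> H j"
    by blast
  then obtain k where k: "n \<le> k" "h \<in> H (Suc k) - H k"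
    using new_trial_at_some_iteration by blast
  have "\<rho> (\<nu> k) \<le> \<epsilon>"
    using rho_bounds(2)[of "\<nu> k"] min_radius_pos[of k] n[OF k(1)] by simp
  then have "ereal (val_lim - \<epsilon>) \<le> ereal (val_lim - \<rho> (\<nu> k))"
    by simp
  also have "\<dots> \<le> f h"
    using k(2) by (rule trial_value_ge)
  finally show ?thesis
    using that h(1) by blast
qed

text \<open>
  A value below \<open>val_lim\<close> would persist, with a uniform margin, on an open set of points, and
  that set would contain late trial points.
\<close>

lemma val_lim_le_where_trials_dense:
  assumes "open B" "B \<subseteq> closure (\<Union>k. H k)" "y \<in> B"
    and parts: "\<And>y. f y \<noteq> \<infinity> \<Longrightarrow> \<exists>S. y \<in> S \<and> S \<subseteq> edom f \<and> ample S \<and>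
      continuous_on S (\<lambda>y. real_of_ereal (f y))"
  shows "ereal val_lim \<le> f y"
proof (rule ccontr)
  assume less: "\<not> ereal val_lim \<le> f y"
  then have "f y \<noteq> \<infinity>"
    by auto
  then obtain S where S: "y \<in> S" "S \<subseteq> edom f" "ample S"
      "continuous_on S (\<lambda>y. real_of_ereal (f y))"
    using parts by blast
  have real: "f u = ereal (real_of_ereal (f u))" if "u \<in> S" for u
    using that S(2) not_minus_infinity[of u] unfolding edom_def by (cases "f u") auto
  have "real_of_ereal (f y) < val_lim"
    using less real[OF S(1)] by (metis ereal_less_eq(3) not_le)
  then obtain c where c: "real_of_ereal (f y) < c" "c < val_lim"
    using dense by blast
  obtain U where U: "open U" "U \<noteq> {}" "U \<subseteq> B" "U \<subseteq> S" "\<And>u. u \<in> U \<Longrightarrow> real_of_ereal (f u) < c"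
    using open_set_below_on_ample[OF assms(1,3) S(1,3,4) c(1)] by blast
  obtain h where h: "h \<in> U" "ereal (val_lim - (val_lim - c)) \<le> f h"
    using late_trial_point[of U "val_lim - c"] U(1-3) assms(2) c(2) by auto
  have "h \<in> S"
    using U(4) h(1) by blast
  then have "ereal c \<le> ereal (real_of_ereal (f h))"
    using h(2) by (simp flip: real)
  then show False
    using U(5)[OF h(1)] by simp
qed

text \<open>
  Lower semicontinuity is relative to the domain, which contains every incumbent. The filter
  \<open>at xs within edom f\<close> omits \<open>xs\<close>, so incumbents equal to \<open>xs\<close> are treated
  separately.
\<close>

lemma lsc_at_refined_point:
  assumes "lsc_on (edom f) (\<lambda>y. real_of_ereal (f y))" "xs \<in> edom f"
    and "filterlim e sequentially sequentially" "(\<lambda>j. x (e j)) \<longlonglongrightarrow> xs"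
  shows "f xs \<le> ereal val_lim"
proof -
  let ?g = "\<lambda>y. real_of_ereal (f y)"
  have "?g xs \<le> val_lim"
  proof (rule ccontr)
    assume "\<not> ?g xs \<le> val_lim"
    then obtain c where c: "val_lim < c" "c < ?g xs"
      using dense not_le by blast
    have "\<forall>\<^sub>F y in at xs within edom f. c < ?g y"
      using assms(1,2) c(2) unfolding lsc_on_def by blast
    then obtain A where A: "open A" "xs \<in> A" "\<And>y. y \<in> A \<Longrightarrow> y \<noteq> xs \<Longrightarrow> y \<in> edom f \<Longrightarrow> c < ?g y"
      unfolding eventually_at_topological by blast
    have "\<forall>\<^sub>F j in sequentially. x (e j) \<in> A"
      using assms(4) A(1,2) by (rule topological_tendstoD)
    moreover have "\<forall>\<^sub>F j in sequentially. val (e j) < c"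
      using filterlim_compose[OF val_tendsto assms(3)] c(1) by (rule order_tendstoD)
    ultimately have "\<forall>\<^sub>F j in sequentially. False"
    proof eventually_elim
      case (elim j)
      have "x (e j) \<in> edom f"
        by (simp add: edom_def incumbent_value)
      then have "c < val (e j)"
        using A(3)[of "x (e j)"] elim(1) c(2) unfolding val_def by (cases "x (e j) = xs") auto
      then show ?case
        using elim(2) by simp
    qed
    then show False
      by simp
  qed
  moreover have "f xs = ereal (?g xs)"
    using assms(2) not_minus_infinity[of xs] unfolding edom_def by (cases "f xs") auto
  ultimately show ?thesis
    by (metis ereal_less_eq(3))
qed

end

theorem theorem1:
  fixes N :: "real ^ 'n \<Rightarrow> real"
    and f :: "real ^ 'n \<Rightarrow> ereal"
    and m :: enat
    and Xs :: "nat \<Rightarrow> (real ^ 'n) set"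
    and r \<tau> :: real
    and M :: "real \<Rightarrow> (real ^ 'n) set"
    and \<rho> :: "real \<Rightarrow> real"
    and x :: "nat \<Rightarrow> real ^ 'n"
    and \<delta> \<nu> :: "nat \<Rightarrow> real"
    and H :: "nat \<Rightarrow> (real ^ 'n) set"
  assumes norm: "is_norm N"
    and not_minus_infinity: "\<And>y. f y \<noteq> -\<infinity>"
    and bounded_below: "\<exists>c::real. \<forall>y. ereal c \<le> f y"
    and bounded_sublevels: "\<And>a::real. bounded {y. f y \<le> ereal a}"
    and lsc: "lsc_on (edom f) (\<lambda>y. real_of_ereal (f y))"
    and number_of_parts: "1 \<le> m"
    and partition: "(\<Union>i\<in>{i. 1 \<le> i \<and> enat i \<le> m}. Xs i) = edom f"
      "disjoint_family_on Xs {i. 1 \<le> i \<and> enat i \<le> m}"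
    and ample_parts: "\<And>i. 1 \<le> i \<Longrightarrow> enat i \<le> m \<Longrightarrow> ample (Xs i)"
    and continuous_parts:
      "\<And>i. 1 \<le> i \<Longrightarrow> enat i \<le> m \<Longrightarrow> continuous_on (Xs i) (\<lambda>y. real_of_ereal (f y))"
    and run: "cdsm_run N f r \<tau> M \<rho> x \<delta> \<nu> H"
  shows "(\<exists>K xs. indexes_refining x \<delta> K xs) \<and>
    ((\<forall>xs\<in>refined_points x \<delta>. norm_ball N r xs \<subseteq> closure (\<Union>k. H k)) \<longrightarrow>
      (\<forall>K xs. indexes_refining x \<delta> K xs \<longrightarrow>
        (if xs \<in> edom f
         then argmin_on f (norm_ball N r xs) xs \<and> (\<lambda>j. f (x (enumerate K j))) \<longlonglongrightarrow> f xs
         else (\<lambda>j. f (x (enumerate K j))) \<longlonglongrightarrow> (INF y\<in>norm_ball N r xs. f y))))"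
proof -
  interpret coercive_cdsm_run N f r \<tau> M \<rho> x \<delta> \<nu> H
    using not_minus_infinity bounded_below bounded_sublevels run by unfold_locales auto
  have parts: "\<exists>S. y \<in> S \<and> S \<subseteq> edom f \<and> ample S \<and> continuous_on S (\<lambda>y. real_of_ereal (f y))"
    if "f y \<noteq> \<infinity>" for y
  proof -
    have "y \<in> edom f"
      using that unfolding edom_def by simp
    then obtain i where "1 \<le> i" "enat i \<le> m" "y \<in> Xs i"
      using partition(1) by blast
    then show ?thesis
      using partition(1) ample_parts continuous_parts by (intro exI[of _ "Xs i"]) blast
  qed
  have "if xs \<in> edom f
         then argmin_on f (norm_ball N r xs) xs \<and> (\<lambda>j. f (x (enumerate K j))) \<longlonglongrightarrow> f xs
         else (\<lambda>j. f (x (enumerate K j))) \<longlonglongrightarrow> (INF y\<in>norm_ball N r xs. f y)"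
    if covering: "\<forall>xs\<in>refined_points x \<delta>. norm_ball N r xs \<subseteq> closure (\<Union>k. H k)"
      and refining: "indexes_refining x \<delta> K xs" for K xs
  proof -
    let ?B = "norm_ball N r xs"
    have K: "filterlim (enumerate K) sequentially sequentially"
        "(\<lambda>j. x (enumerate K j)) \<longlonglongrightarrow> xs"
      using refining filterlim_enumerate unfolding indexes_refining_def comp_def by auto
    have "?B \<subseteq> closure (\<Union>k. H k)"
      using covering refining unfolding refined_points_def by blast
    then have lower: "ereal val_lim \<le> f y" if "y \<in> ?B" for y
      using val_lim_le_where_trials_dense[OF open_norm_ball[OF norm] _ that parts] by blast
    have center: "xs \<in> ?B"
      using norm init(1) by (rule center_in_norm_ball)
    have lim: "(\<lambda>j. f (x (enumerate K j))) \<longlonglongrightarrow> ereal val_lim"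
      unfolding incumbent_value using filterlim_compose[OF val_tendsto K(1)] by simp
    show ?thesis
    proof (cases "xs \<in> edom f")
      case True
      then have "f xs = ereal val_lim"
        using lsc_at_refined_point[OF lsc True K] lower[OF center] by simp
      then show ?thesis
        using True lim lower center by (simp add: argmin_on_iff)
    next
      case False
      have "(INF y\<in>?B. f y) \<le> ereal val_lim"
      proof (rule tendsto_lowerbound[OF lim])
        have "\<forall>\<^sub>F j in sequentially. x (enumerate K j) \<in> ?B"
          using K(2) open_norm_ball[OF norm] center by (rule topological_tendstoD)
        then show "\<forall>\<^sub>F j in sequentially. (INF y\<in>?B. f y) \<le> f (x (enumerate K j))"
          by eventually_elim (rule INF_lower)
      qed simp
      moreover have "ereal val_lim \<le> (INF y\<in>?B. f y)"
        using lower by (rule INF_greatest)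
      ultimately have "(INF y\<in>?B. f y) = ereal val_lim"
        by (rule antisym)
      with lim show ?thesis
        by (simp only: False if_False)
    qed
  qed
  then show ?thesis
    using refining_subsequence_exists by blast
qed

end
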